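(* Let $q$ be a prime power and let $\mathcal{C}\subseteq\mathbb{F}_q^N$ be a $(u,v)$-ordered-batch code of dimension $n$ and redundancy $r=N-n$, where $u,v$ are positive integers. Assume $q\ge\max\{4u\binom{n}{u},7\}$, $v\ge2$ and $uv\le n$. Then $$\binom{r+2u+1-v}{2u}+\sum_{i=1}^{u}\binom{r+2u+1-(v+i)}{2u-i}\binom{v+i-3}{i}\ \ge\ \binom{n}{u},$$ with the convention $\binom{a}{b}=0$ whenever $a<b$.
   Context: $[m]=\{1,\dots,m\}$. A linear code $\mathcal{C}\subseteq\mathbb{F}^N$ of dimension $n$ is systematic if for every $\mathbf{x}\in\mathbb{F}^n$ there is a unique codeword whose first $n$ coordinates equal $\mathbf{x}$. A set $R\subseteq[N]$ is a recovering set for $i\in[n]$ if there are scalars $\lambda_k$ ($k\in R$) with $\mathbf{c}(i)=\sum_{k\in R}\lambda_k\mathbf{c}(k)$ for all $\mathbf{c}\in\mathcal{C}$. $(u,v)$-ordered-batch code: a systematic linear code $\mathcal{C}\subseteq\mathbb{F}^N$ of dimension $n$ such that for every set $I=\{i_1,\dots,i_u\}\subseteq[n]$ of $u$ distinct indices there exist $uv$ pairwise disjoint sets $R_{j,l}\subseteq[N]$ ($j\in[u]$, $l\in[v]$), each $R_{j,l}$ a recovering set for $i_j$, such that the directed graph $D_I$ with vertex set $I$ and an arc $i_j\to i_k$ (for $j,k\in[u]$, $j=k$ allowed) whenever $i_k\in\bigcup_{l=1}^{v}R_{j,l}$, is acyclic (no directed cycles, no loops). *)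

theory Defs
  imports Main
begin

text \<open>Vectors of F^N are modelled as functions nat => F supported on {1..N}
  (coordinates are indexed by [N] = {1..N}).\<close>

definition linear_code :: "nat \<Rightarrow> (nat \<Rightarrow> 'a::field) set \<Rightarrow> bool" where
  "linear_code N C \<longleftrightarrow>
     (\<forall>c\<in>C. \<forall>k. k \<notin> {1..N} \<longrightarrow> c k = 0) \<and>
     (\<lambda>_. 0) \<in> C \<and>
     (\<forall>c\<in>C. \<forall>d\<in>C. (\<lambda>k. c k + d k) \<in> C) \<and>
     (\<forall>a. \<forall>c\<in>C. (\<lambda>k. a * c k) \<in> C)"

definition systematic :: "nat \<Rightarrow> nat \<Rightarrow> (nat \<Rightarrow> 'a::field) set \<Rightarrow> bool" where
  "systematic N n C \<longleftrightarrow> linear_code N C \<and> n \<le> N \<and>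
     (\<forall>x :: nat \<Rightarrow> 'a. \<exists>!c. c \<in> C \<and> (\<forall>i\<in>{1..n}. c i = x i))"

definition recovering_set :: "(nat \<Rightarrow> 'a::field) set \<Rightarrow> nat \<Rightarrow> nat set \<Rightarrow> nat \<Rightarrow> bool" where
  "recovering_set C N R i \<longleftrightarrow> R \<subseteq> {1..N} \<and>
     (\<exists>lam::nat \<Rightarrow> 'a. \<forall>c\<in>C. c i = (\<Sum>k\<in>R. lam k * c k))"

text \<open>The recovering sets for the index set I are given as R j l for j in I, l in {1..v}
  (indexing by the elements of I instead of by positions 1..u).\<close>
definition ordered_batch_code ::
    "nat \<Rightarrow> nat \<Rightarrow> nat \<Rightarrow> nat \<Rightarrow> (nat \<Rightarrow> 'a::field) set \<Rightarrow> bool" where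
  "ordered_batch_code u v N n C \<longleftrightarrow> systematic N n C \<and>
     (\<forall>I. I \<subseteq> {1..n} \<and> card I = u \<longrightarrow>
        (\<exists>R :: nat \<Rightarrow> nat \<Rightarrow> nat set.
           (\<forall>j\<in>I. \<forall>l\<in>{1..v}. recovering_set C N (R j l) j) \<and>
           (\<forall>j\<in>I. \<forall>l\<in>{1..v}. \<forall>j'\<in>I. \<forall>l'\<in>{1..v}.
               (j, l) \<noteq> (j', l') \<longrightarrow> R j l \<inter> R j' l' = {}) \<and>
           acyclic {(j, k). j \<in> I \<and> k \<in> I \<and> k \<in> (\<Union>l\<in>{1..v}. R j l)}))"

end

theory Submission
  imports
    Defs
    "HOL.Vector_Spaces"
    "HOL-Library.FuncSet"
    "HOL-Library.Function_Algebras"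
    "HOL-Library.Multiset"
    "HOL-Combinatorics.Permutations"
begin

text \<open>
  The parity part of a recovering set for \<open>i\<close> is a vector \<open>t\<close> in \<open>F^r\<close> on which the linear
  functionals \<open>E_k\<close>, given by the parity part of the codeword of the \<open>k\<close>-th unit message, satisfy
  \<open>E_i t = 1\<close> and \<open>E_k t = 0\<close> for \<open>k\<close> outside \<open>R \<union> {i}\<close>. For a \<open>u\<close>-set \<open>K\<close> let \<open>f_K\<close> be the
  symmetric \<open>2u\<close>-linear form that sums, over all ways to distribute the arguments in pairs to the
  elements of \<open>K\<close>, the products of the values \<open>E_k\<close>; unlike the polarisation of the product of the
  \<open>E_k^2\<close> it does not degenerate in characteristic 2. Evaluate \<open>f_K\<close> at two vectors \<open>y_j, g_j\<close> per
  \<open>j \<in> I\<close>, where \<open>y_j\<close> comes from the first recovering set of \<open>j\<close> and \<open>g_j\<close> is an affine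
  combination of the vectors of the other \<open>v - 1\<close> sets. An index in \<open>K - I\<close> would need two of these
  vectors with a common support element, and acyclicity leaves a single distribution if \<open>K = I\<close>, so
  the value is \<open>1\<close> if \<open>I = K\<close> and \<open>0\<close> otherwise.

  As \<open>q\<close> exceeds the number of pairs \<open>(I, j)\<close>, there are \<open>v - 2\<close> independent functionals whose common
  kernel contains a suitable \<open>g_j\<close> for every pair at once. In a basis of functionals extending these,
  the identity matrix indexed by \<open>u\<close>-sets factors through the space indexed by the multisets of
  \<open>2u\<close> basis elements of which at most \<open>u\<close> belong to the \<open>v - 2\<close> chosen ones. The left-hand side of
  the bound is the number of these multisets.
\<close>

section \<open>The symmetric \<open>2u\<close>-linear form and its formal properties\<close>

definition pairings :: "'s set \<Rightarrow> 'k set \<Rightarrow> ('s \<Rightarrow> 'k) set" where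
  "pairings A K = {\<pi> \<in> A \<rightarrow>\<^sub>E K. \<forall>k\<in>K. card {a\<in>A. \<pi> a = k} = 2}"

text \<open>This is \<open>f_K\<close> for argument slots \<open>A\<close>. Only the table of values
  enters, \<open>val a k\<close> standing for \<open>E_k\<close> at the argument in slot
  \<open>a\<close>, so symmetry and multilinearity become statements about tables.\<close>

definition pair_form :: "'s set \<Rightarrow> 'k set \<Rightarrow> ('s \<Rightarrow> 'k \<Rightarrow> 'a::comm_ring_1) \<Rightarrow> 'a" where
  "pair_form A K val = (\<Sum>\<pi>\<in>pairings A K. \<Prod>a\<in>A. val a (\<pi> a))"

lemma pair_form_cong:
  assumes "\<And>a k. a \<in> A \<Longrightarrow> k \<in> K \<Longrightarrow> val a k = val' a k"
  shows "pair_form A K val = pair_form A K val'"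
  unfolding pair_form_def pairings_def
  by (intro sum.cong prod.cong refl) (use assms in \<open>auto simp: PiE_iff\<close>)

lemma pairings_permute:
  assumes "p permutes A" "\<pi> \<in> pairings A K"
  shows "restrict (\<pi> \<circ> p) A \<in> pairings A K"
proof -
  have pA: "p a \<in> A \<longleftrightarrow> a \<in> A" for a
    using permutes_in_image[OF assms(1)] .
  have "card {a \<in> A. restrict (\<pi> \<circ> p) A a = k} = card {a \<in> A. \<pi> a = k}" for k
  proof (rule bij_betw_same_card[of p])
    have "p ` {a \<in> A. restrict (\<pi> \<circ> p) A a = k} = {a \<in> A. \<pi> a = k}"
    proof (intro equalityI subsetI)
      fix b assume b: "b \<in> {a \<in> A. \<pi> a = k}"
      then obtain a where "b = p a" "a \<in> A"
        using permutes_image[OF assms(1)] by blast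
      then show "b \<in> p ` {a \<in> A. restrict (\<pi> \<circ> p) A a = k}" using b by auto
    qed (auto simp: pA)
    then show "bij_betw p {a \<in> A. restrict (\<pi> \<circ> p) A a = k} {a \<in> A. \<pi> a = k}"
      using permutes_inj_on[OF assms(1)] by (simp add: bij_betw_def)
  qed
  then show ?thesis
    using assms(2) pA unfolding pairings_def by (auto simp: PiE_iff)
qed

text \<open>Symmetry: a permutation of the slots preserves fibre sizes, so composing with
  \<open>inv p\<close> merely permutes the summands.\<close>

lemma pair_form_permute:
  assumes "p permutes A"
  shows "pair_form A K (\<lambda>a. val (p a)) = pair_form A K val"
proof -
  have pA: "p a \<in> A \<longleftrightarrow> a \<in> A" "inv p a \<in> A \<longleftrightarrow> a \<in> A" for a
    using permutes_in_image[OF assms] permutes_in_image[OF permutes_inv[OF assms]] by auto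
  have inverses: "p (inv p a) = a" "inv p (p a) = a" for a
    using permutes_inverses[OF assms] by auto
  have "(\<Prod>a\<in>A. val a (restrict (\<pi> \<circ> inv p) A a)) = (\<Prod>a\<in>A. val (p a) (\<pi> a))" for \<pi>
    using prod.reindex_bij_betw[OF permutes_imp_bij[OF assms],
        of "\<lambda>a. val a (restrict (\<pi> \<circ> inv p) A a)"]
    by (simp add: pA inverses cong: prod.cong)
  moreover have "restrict (restrict (\<pi> \<circ> f) A \<circ> g) A = \<pi>"
    if "\<pi> \<in> pairings A K" "\<And>a. a \<in> A \<Longrightarrow> g a \<in> A \<and> f (g a) = a" for \<pi> f g
    using that by (auto simp: pairings_def PiE_iff extensional_def fun_eq_iff)
  ultimately show ?thesis
    unfolding pair_form_def
    by (intro sum.reindex_bij_witness[where i = "\<lambda>\<pi>. restrict (\<pi> \<circ> p) A"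
          and j = "\<lambda>\<pi>. restrict (\<pi> \<circ> inv p) A"] pairings_permute assms permutes_inv)
      (simp_all add: pA inverses)
qed

text \<open>Multilinearity: \<open>z a p\<close> are coordinates of the argument in slot
  \<open>a\<close>, and \<open>b k p\<close> are coefficients of \<open>E_k\<close>. Letting
  \<open>D a\<close> depend on the slot makes it possible to drop coordinates that vanish
  there.\<close>

lemma pair_form_expand:
  fixes z :: "'s \<Rightarrow> 'p \<Rightarrow> 'a::comm_ring_1"
  assumes "finite A" "\<And>a. a \<in> A \<Longrightarrow> finite (D a)"
  shows "pair_form A K (\<lambda>a k. \<Sum>p\<in>D a. z a p * b k p) =
    (\<Sum>\<sigma>\<in>PiE A D. (\<Prod>a\<in>A. z a (\<sigma> a)) * pair_form A K (\<lambda>a k. b k (\<sigma> a)))"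
  unfolding pair_form_def
  by (simp add: prod_sum_PiE assms prod.distrib sum_distrib_left) (rule sum.swap)

section \<open>Cardinality bounds from factoring the identity matrix through multisets\<close>

lemma card_le_if_identity_factors:
  fixes c :: "'i \<Rightarrow> 'm \<Rightarrow> 'a::{field,finite}"
  assumes X: "finite X" and M: "finite M"
    and id: "\<And>I K. I \<in> X \<Longrightarrow> K \<in> X \<Longrightarrow> (\<Sum>\<mu>\<in>M. c I \<mu> * d \<mu> K) = of_bool (I = K)"
  shows "card X \<le> card M"
proof -
  \<comment> \<open>A left inverse makes \<open>T\<close> injective on the finite space \<open>F^X\<close>; then compare cardinalities.\<close>
  define T where "T x = restrict (\<lambda>\<mu>. \<Sum>I\<in>X. x I * c I \<mu>) M" for x :: "'i \<Rightarrow> 'a"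
  have recover: "(\<Sum>\<mu>\<in>M. T x \<mu> * d \<mu> K) = x K" if "K \<in> X" for x K
  proof -
    have "(\<Sum>\<mu>\<in>M. T x \<mu> * d \<mu> K) = (\<Sum>\<mu>\<in>M. \<Sum>I\<in>X. x I * (c I \<mu> * d \<mu> K))"
      by (simp add: T_def sum_distrib_right mult.assoc)
    also have "\<dots> = (\<Sum>I\<in>X. x I * (\<Sum>\<mu>\<in>M. c I \<mu> * d \<mu> K))"
      by (subst sum.swap) (simp add: sum_distrib_left)
    also have "\<dots> = (\<Sum>I\<in>X. if I = K then x I else 0)"
      using that by (intro sum.cong) (auto simp: id)
    also have "\<dots> = x K" using X that by simp
    finally show ?thesis .
  qed
  have "inj_on T (X \<rightarrow>\<^sub>E UNIV)"
  proof (rule inj_onI)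
    fix x y assume "x \<in> X \<rightarrow>\<^sub>E UNIV" "y \<in> X \<rightarrow>\<^sub>E UNIV" "T x = T y"
    then show "x = y" using recover[of _ x] recover[of _ y] by (intro PiE_ext[of x]) auto
  qed
  moreover have "T ` (X \<rightarrow>\<^sub>E UNIV) \<subseteq> M \<rightarrow>\<^sub>E UNIV" by (auto simp: T_def)
  ultimately have "card (X \<rightarrow>\<^sub>E (UNIV :: 'a set)) \<le> card (M \<rightarrow>\<^sub>E (UNIV :: 'a set))"
    using M by (intro card_inj_on_le[of T]) (auto intro!: finite_PiE)
  moreover have "1 < card (UNIV :: 'a set)"
    using card_mono[of UNIV "{0, 1 :: 'a}"] by simp
  ultimately show ?thesis
    using X M by (simp add: card_funcsetE)
qed

text \<open>After multilinear expansion, symmetry makes the factor belonging to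
  \<open>\<sigma>\<close> depend on \<open>\<sigma>\<close> only through the multiset of its values.
  Grouping by these multisets factors the identity matrix.\<close>

lemma card_le_card_multisets:
  fixes val :: "'k set \<Rightarrow> 's \<Rightarrow> 'k \<Rightarrow> 'a::{field,finite}"
  assumes X: "finite X" and A: "finite A" and D: "\<And>a. a \<in> A \<Longrightarrow> finite (D a)"
    and val: "\<And>I a k. I \<in> X \<Longrightarrow> a \<in> A \<Longrightarrow> k \<in> \<Union>X \<Longrightarrow> val I a k = (\<Sum>p\<in>D a. z I a p * b k p)"
    and id: "\<And>I K. I \<in> X \<Longrightarrow> K \<in> X \<Longrightarrow> pair_form A K (val I) = of_bool (I = K)"
  shows "card X \<le> card ((\<lambda>\<sigma>. image_mset \<sigma> (mset_set A)) ` PiE A D)"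
proof -
  let ?m = "\<lambda>\<sigma>. image_mset \<sigma> (mset_set A)"
  define c where "c I \<mu> = (\<Sum>\<sigma>\<in>{\<sigma>\<in>PiE A D. ?m \<sigma> = \<mu>}. \<Prod>a\<in>A. z I a (\<sigma> a))" for I \<mu>
  define F where "F K \<sigma> = pair_form A K (\<lambda>a k. b k (\<sigma> a))" for K \<sigma>
  \<comment> \<open>The chosen representative may lie outside \<open>PiE A D\<close>; this is
    harmless, since \<open>F_cong\<close> below holds for arbitrary functions.\<close>
  define d where "d \<mu> K = F K (SOME \<sigma>. ?m \<sigma> = \<mu>)" for \<mu> K
  have F_cong: "F K \<sigma> = F K \<tau>" if eq: "?m \<sigma> = ?m \<tau>" for K \<sigma> \<tau>
  proof -
    obtain p where p: "p permutes A" "\<forall>a\<in>A. \<sigma> a = \<tau> (p a)"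
      using image_mset_eq_implies_permutes[OF A eq] .
    then have "F K \<sigma> = pair_form A K (\<lambda>a k. b k (\<tau> (p a)))"
      unfolding F_def by (intro pair_form_cong) auto
    also have "\<dots> = F K \<tau>"
      unfolding F_def using pair_form_permute[OF p(1), where val = "\<lambda>a k. b k (\<tau> a)"] .
    finally show ?thesis .
  qed
  have d: "d (?m \<sigma>) K = F K \<sigma>" for \<sigma> K
    unfolding d_def by (rule F_cong, rule someI[where P = "\<lambda>\<tau>. ?m \<tau> = ?m \<sigma>"]) simp
  have fin: "finite (PiE A D)" using A D by (rule finite_PiE)
  show ?thesis
  proof (rule card_le_if_identity_factors[where c = c and d = d, OF X])
    show "finite (?m ` PiE A D)" using fin by blast
    fix I K assume IK: "I \<in> X" "K \<in> X"
    have "of_bool (I = K) = pair_form A K (val I)" using id IK by simp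
    also have "\<dots> = pair_form A K (\<lambda>a k. \<Sum>p\<in>D a. z I a p * b k p)"
      using IK by (intro pair_form_cong val) auto
    also have "\<dots> = (\<Sum>\<sigma>\<in>PiE A D. (\<Prod>a\<in>A. z I a (\<sigma> a)) * F K \<sigma>)"
      unfolding F_def by (rule pair_form_expand[OF A D])
    also have "\<dots> = (\<Sum>\<mu>\<in>?m ` PiE A D.
        \<Sum>\<sigma>\<in>{\<sigma>\<in>PiE A D. ?m \<sigma> = \<mu>}. (\<Prod>a\<in>A. z I a (\<sigma> a)) * F K \<sigma>)"
      using fin by (intro sum.group[symmetric]) auto
    also have "\<dots> = (\<Sum>\<mu>\<in>?m ` PiE A D. c I \<mu> * d \<mu> K)"
      unfolding c_def sum_distrib_right by (intro sum.cong refl) (auto simp: d)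
    finally show "(\<Sum>\<mu>\<in>?m ` PiE A D. c I \<mu> * d \<mu> K) = of_bool (I = K)" by simp
  qed
qed

text \<open>Values in \<open>S\<close> can occur only in the \<open>u\<close> slots with second
  component \<open>True\<close>. Splitting a multiset into its parts inside and outside
  \<open>S\<close> therefore gives sizes \<open>i\<close> and \<open>2*u - i\<close> with
  \<open>i \<le> u\<close>.\<close>

lemma card_image_multisets_le:
  fixes B S :: "'p set" and u :: nat
  assumes B: "finite B" "S \<subseteq> B"
  defines "A \<equiv> {..<u} \<times> (UNIV :: bool set)"
  defines "D \<equiv> (\<lambda>a. if snd a then B else B - S)"
  shows "card ((\<lambda>\<sigma>. image_mset \<sigma> (mset_set A)) ` PiE A D)
    \<le> (\<Sum>i\<le>u. ((card S + i - 1) choose i) * ((card (B - S) + (2*u - i) - 1) choose (2*u - i)))"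
proof -
  have finS: "finite S" "finite (B - S)" using B finite_subset by auto
  have finA: "finite A" unfolding A_def by simp
  let ?P = "\<lambda>i. multisets_of_size S i \<times> multisets_of_size (B - S) (2*u - i)"
  let ?f = "\<lambda>(x, y). x + y :: 'p multiset"
  have "(\<lambda>\<sigma>. image_mset \<sigma> (mset_set A)) ` PiE A D \<subseteq> (\<Union>i\<le>u. ?f ` ?P i)"
  proof (rule image_subsetI)
    fix \<sigma> assume \<sigma>: "\<sigma> \<in> PiE A D"
    define \<mu> where "\<mu> = image_mset \<sigma> (mset_set A)"
    define x where "x = filter_mset (\<lambda>p. p \<in> S) \<mu>"
    define y where "y = filter_mset (\<lambda>p. p \<notin> S) \<mu>"
    have xy: "\<mu> = x + y" unfolding x_def y_def by (rule multiset_partition)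
    have "size \<mu> = 2 * u" unfolding \<mu>_def A_def by (simp add: card_cartesian_product)
    moreover have "set_mset \<mu> \<subseteq> B"
      using \<sigma> finA unfolding \<mu>_def D_def by (auto simp: PiE_iff split: if_splits)
    moreover have "size x \<le> u"
    proof -
      have "size x = card {a\<in>A. \<sigma> a \<in> S}"
        unfolding x_def \<mu>_def by (simp add: filter_mset_image_mset finA)
      also have "\<dots> \<le> card ({..<u} \<times> {True})"
      proof (rule card_mono)
        show "{a \<in> A. \<sigma> a \<in> S} \<subseteq> {..<u} \<times> {True}"
          using \<sigma> unfolding A_def D_def by (force simp: PiE_iff split: if_splits)
      qed simp
      finally show ?thesis by (simp add: card_cartesian_product)
    qed
    moreover have "size \<mu> = size x + size y" using xy by simp
    ultimately have "(x, y) \<in> ?P (size x)" "size x \<le> u"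
      unfolding multisets_of_size_def by (auto simp: x_def y_def)
    then show "\<mu> \<in> (\<Union>i\<le>u. ?f ` ?P i)"
      using xy by force
  qed
  then have "card ((\<lambda>\<sigma>. image_mset \<sigma> (mset_set A)) ` PiE A D) \<le> card (\<Union>i\<le>u. ?f ` ?P i)"
    using finS by (intro card_mono) (auto intro!: finite_imageI finite_cartesian_product)
  also have "\<dots> \<le> (\<Sum>i\<le>u. card (?f ` ?P i))"
    by (rule card_UN_le) simp
  also have "\<dots> \<le> (\<Sum>i\<le>u. card (?P i))"
    using finS by (intro sum_mono card_image_le) (auto intro!: finite_cartesian_product)
  also have "\<dots> = (\<Sum>i\<le>u. ((card S + i - 1) choose i) * ((card (B - S) + (2*u - i) - 1) choose (2*u - i)))"
    using finS by (simp add: card_cartesian_product card_multisets_of_size)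
  finally show ?thesis .
qed

section \<open>Evaluation of the form as a Kronecker delta\<close>

text \<open>The slots \<open>(m, True)\<close> and \<open>(m, False)\<close> carry the two arguments
  of the index \<open>e m\<close>. If \<open>K\<close> differs from \<open>I\<close>, equal
  cardinalities give some \<open>k\<close> in \<open>K - I\<close>; it receives two slots, and
  \<open>disj\<close> kills every product. If \<open>K = I\<close>, only the pairing sending each
  slot to its own index survives.\<close>

lemma pair_form_eq_of_bool:
  fixes val :: "nat \<times> bool \<Rightarrow> 'k \<Rightarrow> 'a::field"
  assumes e: "bij_betw e {..<u} I" and K: "finite K" "card K = u"
    and arcs: "arcs \<subseteq> I \<times> I" "acyclic arcs"
    and diag: "\<And>a. a \<in> {..<u} \<times> UNIV \<Longrightarrow> val a (e (fst a)) = 1"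
    and arc: "\<And>a k. a \<in> {..<u} \<times> UNIV \<Longrightarrow> k \<in> I \<Longrightarrow> k \<noteq> e (fst a) \<Longrightarrow> val a k \<noteq> 0 \<Longrightarrow> (e (fst a), k) \<in> arcs"
    and disj: "\<And>a a' k. a \<in> {..<u} \<times> UNIV \<Longrightarrow> a' \<in> {..<u} \<times> UNIV \<Longrightarrow> a \<noteq> a' \<Longrightarrow>
      k \<in> K - I \<Longrightarrow> val a k = 0 \<or> val a' k = 0"
  shows "pair_form ({..<u} \<times> UNIV) K val = of_bool (I = K)"
proof -
  let ?A = "{..<u} \<times> (UNIV :: bool set)"
  have I: "finite I" "card I = u" using e bij_betw_finite bij_betw_same_card by fastforce+
  show ?thesis
  proof (cases "I = K")
    case False
    then obtain k where k: "k \<in> K - I" using I K by (metis Diff_eq_empty_iff all_not_in_conv card_subset_eq)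
    have "(\<Prod>a\<in>?A. val a (\<pi> a)) = 0" if "\<pi> \<in> pairings ?A K" for \<pi>
    proof -
      have "card {a\<in>?A. \<pi> a = k} = 2" using that k unfolding pairings_def by blast
      then obtain a a' where "{a\<in>?A. \<pi> a = k} = {a, a'}" "a \<noteq> a'" by (meson card_2_iff)
      then have a: "a \<in> ?A" "a' \<in> ?A" "a \<noteq> a'" "\<pi> a = k" "\<pi> a' = k" by blast+
      then have "val a (\<pi> a) = 0 \<or> val a' (\<pi> a') = 0" using disj k by metis
      then have "\<exists>a\<in>?A. val a (\<pi> a) = 0" using a(1,2) by blast
      then show ?thesis by (intro prod_zero) auto
    qed
    then have "pair_form ?A K val = 0" unfolding pair_form_def by (intro sum.neutral ballI)
    then show ?thesis using False by simp
  next
    case True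
    define \<pi>0 where "\<pi>0 = restrict (\<lambda>a. e (fst a)) ?A"
    have inj: "e m = e m' \<longleftrightarrow> m = m'" if "m < u" "m' < u" for m m'
      using e that unfolding bij_betw_def inj_on_def by auto
    have fibre: "{a\<in>?A. e (fst a) = e m} = {m} \<times> UNIV" if "m < u" for m
      using inj that by auto
    have \<pi>0: "\<pi>0 \<in> pairings ?A K"
    proof -
      have "card {a\<in>?A. \<pi>0 a = k} = 2" if k: "k \<in> I" for k
      proof -
        obtain m where "m < u" "k = e m" using e k unfolding bij_betw_def by auto
        then have "{a\<in>?A. \<pi>0 a = k} = {m} \<times> UNIV" using fibre[of m] unfolding \<pi>0_def by auto
        then show ?thesis by (simp add: card_cartesian_product)
      qed
      moreover have "\<pi>0 \<in> ?A \<rightarrow>\<^sub>E I" using e unfolding \<pi>0_def bij_betw_def by auto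
      ultimately show ?thesis unfolding pairings_def using True by auto
    qed
    have "finite arcs" using arcs(1) I(1) finite_subset by blast
    then have wf: "wf (arcs\<inverse>)" using arcs(2) by (rule finite_acyclic_wf_converse)
    have zero: "(\<Prod>a\<in>?A. val a (\<pi> a)) = 0" if \<pi>: "\<pi> \<in> pairings ?A K" and "\<pi> \<noteq> \<pi>0" for \<pi>
    proof (rule ccontr)
      assume "(\<Prod>a\<in>?A. val a (\<pi> a)) \<noteq> 0"
      then have nz: "val a (\<pi> a) \<noteq> 0" if "a \<in> ?A" for a using that by (auto simp: prod_zero_iff)
      have \<pi>K: "\<pi> \<in> ?A \<rightarrow>\<^sub>E I" and two: "\<And>k. k \<in> I \<Longrightarrow> card {a\<in>?A. \<pi> a = k} = 2"
        using \<pi> True unfolding pairings_def by auto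
      \<comment> \<open>Starting from the sinks of \<open>arcs\<close>: once both slots of every out-neighbour of \<open>e m\<close> are
        placed at their own index, those indices are full and the slots of \<open>m\<close> must go to \<open>e m\<close>.\<close>
      have "\<forall>m<u. k = e m \<longrightarrow> (\<forall>b. \<pi> (m, b) = k)" for k
        using wf
      proof (induction k rule: wf_induct_rule)
        case (less k)
        show ?case
        proof (intro allI impI, rule ccontr)
          fix m b assume m: "m < u" "k = e m" and ne: "\<pi> (m, b) \<noteq> k"
          have inI: "\<pi> (m, b) \<in> I" using \<pi>K m by auto
          then have "(k, \<pi> (m, b)) \<in> arcs" using arc[of "(m, b)" "\<pi> (m, b)"] nz[of "(m, b)"] m ne by auto
          moreover obtain m' where m': "m' < u" "\<pi> (m, b) = e m'"
            using inI e unfolding bij_betw_def by auto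
          ultimately have IH: "\<pi> (m', b') = e m'" for b' using less[of "e m'"] by auto
          have "m \<noteq> m'" using ne m m' by auto
          then have "card {(m, b), (m', True), (m', False)} = 3" by simp
          moreover have "card {(m, b), (m', True), (m', False)} \<le> card {a\<in>?A. \<pi> a = e m'}"
            using IH m m' by (intro card_mono finite_subset[of "{a\<in>?A. \<pi> a = e m'}" ?A]) auto
          ultimately have "3 \<le> card {a\<in>?A. \<pi> a = e m'}" by simp
          then show False using two[of "e m'"] inI m' by simp
        qed
      qed
      then have "\<pi> = \<pi>0" using \<pi>K unfolding \<pi>0_def
        by (intro ext) (auto simp: PiE_iff extensional_def)
      then show False using that by blast
    qed
    have fin: "finite (pairings ?A K)" unfolding pairings_def using K(1)
      by (intro finite_subset[OF _ finite_PiE[of ?A "\<lambda>_. K"]]) auto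
    have "pair_form ?A K val = (\<Sum>\<pi>\<in>{\<pi>0}. \<Prod>a\<in>?A. val a (\<pi> a))"
      unfolding pair_form_def using \<pi>0 zero fin by (intro sum.mono_neutral_right) auto
    also have "\<dots> = 1" using diag by (simp add: \<pi>0_def)
    finally show ?thesis using True by simp
  qed
qed


section \<open>Linear functionals on \<open>F^r\<close>\<close>

definition dot :: "nat \<Rightarrow> (nat \<Rightarrow> 'a::comm_ring_1) \<Rightarrow> (nat \<Rightarrow> 'a) \<Rightarrow> 'a" where
  "dot r f t = (\<Sum>p<r. f p * t p)"

lemma dot_add_right: "dot r f (\<lambda>p. t p + t' p) = dot r f t + dot r f t'"
  by (simp add: dot_def distrib_left sum.distrib)

lemma dot_diff_right: "dot r f (\<lambda>p. t p - t' p) = dot r f t - dot r f t'"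
  by (simp add: dot_def right_diff_distrib sum_subtractf)

lemma dot_scale_right: "dot r f (\<lambda>p. c * t p) = c * dot r f t"
  by (simp add: dot_def sum_distrib_left mult.left_commute)

lemma dot_sum_right: "dot r f (\<lambda>p. \<Sum>i\<in>J. t i p) = (\<Sum>i\<in>J. dot r f (t i))"
  unfolding dot_def sum_distrib_left by (rule sum.swap)

lemma dot_commute: "dot r f t = dot r t f"
  by (simp add: dot_def mult.commute)

lemmas dot_linear = dot_add_right dot_diff_right dot_scale_right dot_sum_right

text \<open>Induction on \<open>X\<close>: the functional found so far is moved along a line in the
  direction of a coordinate where the new vector is nonzero. Each vector rules out at most one
  scalar on that line, and the field has more scalars than there are vectors.\<close>

lemma exists_common_nonvanishing_functional:
  fixes d :: "'x \<Rightarrow> nat \<Rightarrow> 'a::{field,finite}"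
  assumes "finite X" "card X < card (UNIV :: 'a set)" "\<And>x. x \<in> X \<Longrightarrow> \<exists>p<r. d x p \<noteq> 0"
  shows "\<exists>f. (\<forall>p\<ge>r. f p = 0) \<and> (\<forall>x\<in>X. dot r f (d x) \<noteq> 0)"
  using assms
proof (induction X rule: finite_induct)
  case empty
  then show ?case by (intro exI[of _ "\<lambda>_. 0"]) auto
next
  case (insert y X)
  then obtain f where f: "\<forall>p\<ge>r. f p = 0" "\<forall>x\<in>X. dot r f (d x) \<noteq> 0" by auto
  obtain p where p: "p < r" "d y p \<noteq> 0" using insert.prems by blast
  define g where "g c = (\<lambda>i. f i + c * of_bool (i = p))" for c :: 'a
  have g: "dot r (g c) t = dot r f t + c * t p" for c t
  proof -
    have "dot r (g c) t = dot r f t + (\<Sum>i<r. if i = p then c * t i else 0)"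
      unfolding dot_def g_def sum.distrib[symmetric] by (intro sum.cong) (auto simp: algebra_simps)
    then show ?thesis using p by simp
  qed
  \<comment> \<open>If \<open>d x p = 0\<close>, the quotient is \<open>0\<close> by convention.
    Such an \<open>x\<close> is an old vector, whose value does not depend on \<open>c\<close>, so
    excluding one more scalar does no harm.\<close>
  define bad where "bad = (\<lambda>x. - dot r f (d x) / d x p) ` insert y X"
  have "card bad \<le> card (insert y X)" unfolding bad_def by (rule card_image_le) (use insert in simp)
  then have "bad \<noteq> UNIV" using insert.prems(1) by auto
  then obtain c where c: "c \<notin> bad" by blast
  have "dot r (g c) (d x) \<noteq> 0" if x: "x \<in> insert y X" for x
  proof
    assume 0: "dot r (g c) (d x) = 0"
    show False
    proof (cases "d x p = 0")
      case True
      then show False using 0 x f p g by auto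
    next
      case False
      then have "c = - dot r f (d x) / d x p"
        using 0 g by (simp add: field_simps eq_neg_iff_add_eq_0)
      then show False using c x unfolding bad_def by blast
    qed
  qed
  moreover have "\<forall>i\<ge>r. g c i = 0" using f p unfolding g_def by auto
  ultimately show ?case by blast
qed

text \<open>The common kernel of the \<open>\<phi> m\<close> has to meet every affine space
  \<open>w x + span (d x i)\<close>. Induction on \<open>s\<close>: the last functional is nonzero
  on all \<open>d x s\<close>, and projecting along \<open>d x s\<close> leaves a problem with
  \<open>s - 1\<close> directions. The last conjunct, nonsingularity of the matrix of values, later
  yields independence of the \<open>\<phi> m\<close>.\<close>

lemma exists_transversal_functionals:
  fixes w :: "'x \<Rightarrow> nat \<Rightarrow> 'a::{field,finite}" and d :: "'x \<Rightarrow> nat \<Rightarrow> nat \<Rightarrow> 'a"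
  assumes X: "finite X" "card X < card (UNIV :: 'a set)"
    and indep: "\<forall>x\<in>X. \<forall>a. (\<forall>p<r. (\<Sum>i<s. a i * d x i p) = 0) \<longrightarrow> (\<forall>i<s. a i = 0)"
  shows "\<exists>\<phi>. (\<forall>m<s. \<forall>p\<ge>r. \<phi> m p = 0) \<and>
    (\<forall>x\<in>X. \<exists>a. \<forall>m<s. dot r (\<phi> m) (\<lambda>p. w x p + (\<Sum>i<s. a i * d x i p)) = 0) \<and>
    (\<forall>x\<in>X. \<forall>c. (\<forall>i<s. (\<Sum>m<s. c m * dot r (\<phi> m) (d x i)) = 0) \<longrightarrow> (\<forall>m<s. c m = 0))"
  using indep
proof (induction s arbitrary: w d)
  case 0
  then show ?case by auto
next
  case (Suc s)
  have "\<exists>p<r. d x s p \<noteq> 0" if "x \<in> X" for x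
  proof (rule ccontr)
    assume "\<not> ?thesis"
    then have "\<forall>p<r. (\<Sum>i<Suc s. of_bool (i = s) * d x i p) = 0" by (auto intro!: sum.neutral)
    then show False using bspec[OF Suc.prems that, THEN spec, of "\<lambda>i. of_bool (i = s)"] by auto
  qed
  then obtain f where f: "\<forall>p\<ge>r. f p = 0" "\<And>x. x \<in> X \<Longrightarrow> dot r f (d x s) \<noteq> 0"
    using exists_common_nonvanishing_functional[OF X, of r "\<lambda>x. d x s"] by blast
  \<comment> \<open>Projection along \<open>d x s\<close> onto the kernel of \<open>f\<close>, where the remaining functionals are sought.\<close>
  define proj where "proj x t = (\<lambda>p. t p - dot r f t / dot r f (d x s) * d x s p)" for x t
  have f_proj: "dot r f (proj x t) = 0" if "x \<in> X" for x t
    using f(2)[OF that] unfolding proj_def dot_linear by simp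
  define w' where "w' x = proj x (w x)" for x
  define d' where "d' x i = proj x (d x i)" for x i
  \<comment> \<open>The multiples of \<open>d x s\<close> subtracted by the projections are
    collected in a single last coefficient.\<close>
  have comb: "(\<Sum>i<s. a i * d' x i p) = (\<Sum>i<Suc s. (if i < s then a i else
      - (\<Sum>i<s. a i * (dot r f (d x i) / dot r f (d x s)))) * d x i p)" for x a p
    by (simp add: d'_def proj_def right_diff_distrib sum_subtractf sum_distrib_right mult.assoc)
  have "\<forall>x\<in>X. \<forall>a. (\<forall>p<r. (\<Sum>i<s. a i * d' x i p) = 0) \<longrightarrow> (\<forall>i<s. a i = 0)"
  proof (intro ballI allI impI)
    fix x a i assume x: "x \<in> X" and zero: "\<forall>p<r. (\<Sum>i<s. a i * d' x i p) = 0" and i: "i < s"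
    define b where "b i = (if i < s then a i else
      - (\<Sum>i<s. a i * (dot r f (d x i) / dot r f (d x s))))" for i
    have "\<forall>p<r. (\<Sum>i<Suc s. b i * d x i p) = 0" using zero unfolding comb b_def .
    then have "\<forall>i<Suc s. b i = 0" by (rule bspec[OF Suc.prems x, THEN spec, THEN mp])
    then show "a i = 0" using i unfolding b_def by (metis less_SucI)
  qed
  from Suc.IH[OF this, where w = w'] obtain \<phi> where \<phi>: "\<forall>m<s. \<forall>p\<ge>r. \<phi> m p = 0"
    and sol: "\<forall>x\<in>X. \<exists>a. \<forall>m<s. dot r (\<phi> m) (\<lambda>p. w' x p + (\<Sum>i<s. a i * d' x i p)) = 0"
    and nondeg: "\<forall>x\<in>X. \<forall>c. (\<forall>i<s. (\<Sum>m<s. c m * dot r (\<phi> m) (d' x i)) = 0) \<longrightarrow> (\<forall>m<s. c m = 0)"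
    by blast
  define \<psi> where "\<psi> m = (if m < s then \<phi> m else f)" for m
  have "\<forall>x\<in>X. \<exists>a. \<forall>m<Suc s. dot r (\<psi> m) (\<lambda>p. w x p + (\<Sum>i<Suc s. a i * d x i p)) = 0"
  proof
    fix x assume x: "x \<in> X"
    obtain a where a: "\<forall>m<s. dot r (\<phi> m) (\<lambda>p. w' x p + (\<Sum>i<s. a i * d' x i p)) = 0"
      using sol x by blast
    have f0: "dot r f (\<lambda>p. w' x p + (\<Sum>i<s. a i * d' x i p)) = 0"
      using f_proj[OF x] by (simp add: dot_linear w'_def d'_def)
    \<comment> \<open>The last coefficient also absorbs the projection of \<open>w x\<close>, so
      that the point found for the projected data lies in the original affine space.\<close>
    define b where "b i = (if i < s then a i else - dot r f (w x) / dot r f (d x s)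
      - (\<Sum>i<s. a i * (dot r f (d x i) / dot r f (d x s))))" for i
    have "(\<lambda>p. w' x p + (\<Sum>i<s. a i * d' x i p)) = (\<lambda>p. w x p + (\<Sum>i<Suc s. b i * d x i p))"
      unfolding comb by (simp add: fun_eq_iff b_def w'_def proj_def algebra_simps)
    then have "\<forall>m<Suc s. dot r (\<psi> m) (\<lambda>p. w x p + (\<Sum>i<Suc s. b i * d x i p)) = 0"
      using a f0 unfolding \<psi>_def by simp
    then show "\<exists>a. \<forall>m<Suc s. dot r (\<psi> m) (\<lambda>p. w x p + (\<Sum>i<Suc s. a i * d x i p)) = 0"
      by (rule exI[of _ b])
  qed
  moreover have "\<forall>x\<in>X. \<forall>c. (\<forall>i<Suc s. (\<Sum>m<Suc s. c m * dot r (\<psi> m) (d x i)) = 0) \<longrightarrow>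
    (\<forall>m<Suc s. c m = 0)"
  proof (intro ballI allI impI)
    fix x c k
    assume x: "x \<in> X" and c: "\<forall>i<Suc s. (\<Sum>m<Suc s. c m * dot r (\<psi> m) (d x i)) = 0"
      and k: "k < Suc s"
    have eq: "(\<Sum>m<s. c m * dot r (\<phi> m) (d x i)) = - c s * dot r f (d x i)" if "i < Suc s" for i
      using c that by (simp add: \<psi>_def eq_neg_iff_add_eq_0)
    \<comment> \<open>The combination of all functionals vanishes on every \<open>d x i\<close>,
      hence on the projected directions; since \<open>f\<close> vanishes there too, its term drops
      out.\<close>
    have "(\<Sum>m<s. c m * dot r (\<phi> m) (d' x i)) = 0" if "i < s" for i
    proof -
      let ?q = "dot r f (d x i) / dot r f (d x s)"
      have "(\<Sum>m<s. c m * dot r (\<phi> m) (d' x i)) =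
          (\<Sum>m<s. c m * dot r (\<phi> m) (d x i)) - ?q * (\<Sum>m<s. c m * dot r (\<phi> m) (d x s))"
        unfolding d'_def proj_def dot_linear
        by (simp add: right_diff_distrib sum_subtractf sum_distrib_left mult.left_commute)
      also have "\<dots> = 0" using eq[of i] eq[of s] f(2)[OF x] that by simp
      finally show ?thesis .
    qed
    then have c0: "\<forall>m<s. c m = 0" using nondeg x by blast
    then have "c s * dot r f (d x s) = 0" using eq[of s] by simp
    then show "c k = 0" using c0 f(2)[OF x] k by (auto simp: less_Suc_eq)
  qed
  moreover have "\<forall>m<Suc s. \<forall>p\<ge>r. \<psi> m p = 0" using \<phi> f unfolding \<psi>_def by auto
  ultimately show ?case by (intro exI[of _ \<psi>] conjI)
qed

text \<open>The \<open>\<phi> m\<close> extend to a basis of the functionals supported below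
  \<open>r\<close>, a space spanned by \<open>r\<close> unit functionals. As the basis is a set,
  injectivity of \<open>\<phi>\<close> is needed to count the chosen functionals.\<close>

lemma extend_functionals_to_basis:
  fixes \<phi> :: "nat \<Rightarrow> nat \<Rightarrow> 'a::field"
  assumes supp: "\<forall>m<s. \<forall>p\<ge>r. \<phi> m p = 0"
    and indep: "\<And>c. \<forall>p. (\<Sum>m<s. c m * \<phi> m p) = 0 \<Longrightarrow> \<forall>m<s. c m = 0"
  obtains B where "finite B" "\<phi> ` {..<s} \<subseteq> B" "card B \<le> r" "card (\<phi> ` {..<s}) = s"
    "\<And>f. \<exists>\<beta>. \<forall>t. dot r f t = (\<Sum>g\<in>B. \<beta> g * dot r g t)"
proof -
  interpret fs: vector_space "\<lambda>c (f :: nat \<Rightarrow> 'a) p. c * f p"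
    by unfold_locales (auto simp: fun_eq_iff algebra_simps)
  have sum_apply: "(\<Sum>x\<in>Y. F x) p = (\<Sum>x\<in>Y. F x p)" for Y and F :: "'y \<Rightarrow> nat \<Rightarrow> 'a" and p
    by (induction Y rule: infinite_finite_induct) auto
  define V where "V = {f :: nat \<Rightarrow> 'a. \<forall>p\<ge>r. f p = 0}"
  define unit :: "nat \<Rightarrow> nat \<Rightarrow> 'a" where "unit i = (\<lambda>p. of_bool (p = i))" for i
  have inj: "inj_on \<phi> {..<s}"
  proof (rule inj_onI, rule ccontr)
    fix m m' assume m: "m \<in> {..<s}" "m' \<in> {..<s}" "\<phi> m = \<phi> m'" "m \<noteq> m'"
    define c :: "nat \<Rightarrow> 'a" where "c i = of_bool (i = m) - of_bool (i = m')" for i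
    have "(\<Sum>i<s. c i * \<phi> i p) = (\<Sum>i<s. (if i = m then \<phi> i p else 0) - (if i = m' then \<phi> i p else 0))" for p
      by (intro sum.cong) (auto simp: c_def)
    then have "\<forall>p. (\<Sum>i<s. c i * \<phi> i p) = 0" using m by (simp add: sum_subtractf)
    then show False using indep[of c] m by (auto simp: c_def)
  qed
  have ind: "fs.independent (\<phi> ` {..<s})"
  proof (rule fs.independent_if_scalars_zero)
    fix c x assume 0: "(\<Sum>x\<in>\<phi> ` {..<s}. (\<lambda>p. c x * x p)) = 0" and x: "x \<in> \<phi> ` {..<s}"
    have "(\<Sum>m<s. c (\<phi> m) * \<phi> m p) = 0" for p
      using fun_cong[OF 0, of p] unfolding sum.reindex[OF inj] by (simp add: sum_apply)
    then show "c x = 0" using indep[of "\<lambda>m. c (\<phi> m)"] x by auto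
  qed simp
  have "\<phi> ` {..<s} \<subseteq> V" using supp unfolding V_def by auto
  then obtain B where B: "\<phi> ` {..<s} \<subseteq> B" "B \<subseteq> V" "fs.independent B" "V \<subseteq> fs.span B"
    using fs.maximal_independent_subset_extend ind by metis
  have "V \<subseteq> fs.span (unit ` {..<r})"
  proof
    fix f assume f: "f \<in> V"
    have "f = (\<Sum>i<r. (\<lambda>p. f i * unit i p))"
    proof
      fix p
      have "(\<Sum>i<r. f i * unit i p) = (\<Sum>i<r. if i = p then f i else 0)"
        by (intro sum.cong) (auto simp: unit_def)
      then show "f p = (\<Sum>i<r. (\<lambda>p. f i * unit i p)) p"
        using f by (auto simp: sum_apply V_def)
    qed
    also have "\<dots> \<in> fs.span (unit ` {..<r})"
      by (intro fs.span_sum fs.span_scale fs.span_base) auto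
    finally show "f \<in> fs.span (unit ` {..<r})" .
  qed
  then have "finite B \<and> card B \<le> card (unit ` {..<r})"
    using B by (intro fs.independent_span_bound) auto
  moreover have "card (unit ` {..<r}) \<le> r" using card_image_le[of "{..<r}" unit] by simp
  ultimately have finB: "finite B" and cardB: "card B \<le> r" by auto
  have "\<exists>\<beta>. \<forall>t. dot r f t = (\<Sum>g\<in>B. \<beta> g * dot r g t)" for f
  proof -
    \<comment> \<open>An arbitrary \<open>f\<close> may be nonzero beyond \<open>r\<close>, where
      \<open>dot\<close> does not look; its truncation lies in \<open>V\<close>.\<close>
    define f' where "f' p = (if p < r then f p else 0)" for p
    have "f' \<in> fs.span B" using B unfolding V_def f'_def by auto
    then obtain \<beta> where \<beta>: "f' = (\<Sum>g\<in>B. (\<lambda>p. \<beta> g * g p))"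
      unfolding fs.span_finite[OF finB] by blast
    have "dot r f t = (\<Sum>g\<in>B. \<beta> g * dot r g t)" for t
    proof -
      have "dot r f t = dot r t f'" unfolding dot_def f'_def by (intro sum.cong) auto
      also have "f' = (\<lambda>p. \<Sum>g\<in>B. \<beta> g * g p)" using \<beta> by (simp add: fun_eq_iff sum_apply)
      finally show ?thesis by (simp add: dot_linear dot_commute[of r t])
    qed
    then show ?thesis by blast
  qed
  then show ?thesis using that finB B(1) cardB card_image[OF inj] by simp
qed

section \<open>From recovering sets to vectors in the parity space\<close>

text \<open>The recovery identity is tested on the codewords of the unit messages; \<open>t\<close>
  is the parity part of its coefficients. The family \<open>G\<close> depends only on the code, so
  it serves all recovering sets at once.\<close>

lemma systematic_recovery_vectors:
  fixes C :: "(nat \<Rightarrow> 'a::field) set"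
  assumes "systematic N n C"
  shows "\<exists>G :: nat \<Rightarrow> nat \<Rightarrow> 'a. \<forall>R i. recovering_set C N R i \<longrightarrow> i \<in> {1..n} - R \<longrightarrow>
    (\<exists>t. (\<forall>p. t p \<noteq> 0 \<longrightarrow> Suc (n + p) \<in> R) \<and> dot (N - n) (G i) t = 1 \<and>
      (\<forall>k\<in>{1..n} - R - {i}. dot (N - n) (G k) t = 0))"
proof -
  define r where "r = N - n"
  have nN: "n \<le> N" using assms unfolding systematic_def by blast
  have "\<exists>!c. c \<in> C \<and> (\<forall>i\<in>{1..n}. c i = x i)" for x
    using assms unfolding systematic_def by simp
  then have "\<exists>c. c \<in> C \<and> (\<forall>i\<in>{1..n}. c i = of_bool (i = k))" for k
    by (rule ex1_implies_ex)
  then obtain c where c: "\<And>k. c k \<in> C" "\<And>k i. i \<in> {1..n} \<Longrightarrow> c k i = of_bool (i = k)" by metis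
  \<comment> \<open>Parity positions count from \<open>0\<close>: position \<open>p\<close> is code
    coordinate \<open>n + 1 + p\<close>.\<close>
  define G where "G k p = c k (Suc (n + p))" for k p
  have "\<exists>t. (\<forall>p. t p \<noteq> 0 \<longrightarrow> Suc (n + p) \<in> R) \<and> dot r (G i) t = 1 \<and>
      (\<forall>k\<in>{1..n} - R - {i}. dot r (G k) t = 0)"
    if R: "recovering_set C N R i" "i \<in> {1..n}" "i \<notin> R" for R i
  proof -
    obtain lam where RN: "R \<subseteq> {1..N}" and lam: "\<And>x. x \<in> C \<Longrightarrow> x i = (\<Sum>k\<in>R. lam k * x k)"
      using R(1) unfolding recovering_set_def by blast
    define t where "t p = (if Suc (n + p) \<in> R then lam (Suc (n + p)) else 0)" for p
    have dot: "dot r (G k) t = of_bool (i = k)" if k: "k \<in> {1..n} - R" for k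
    proof -
      let ?g = "\<lambda>m. if m \<in> R then lam m * c k m else 0"
      have "of_bool (i = k) = (\<Sum>m\<in>R. lam m * c k m)" using lam[OF c(1), of k] c(2) R by simp
      also have "\<dots> = (\<Sum>m\<in>{1..N}. ?g m)" using RN by (intro sum.mono_neutral_cong_left) auto
      \<comment> \<open>Among the message coordinates, \<open>c k\<close> is nonzero only at
        \<open>k\<close>, which lies outside \<open>R\<close>.\<close>
      also have "\<dots> = (\<Sum>m\<in>{n<..N}. ?g m)"
        using nN k by (intro sum.mono_neutral_right) (auto simp: c(2))
      also have "\<dots> = (\<Sum>p<r. ?g (Suc (n + p)))"
        unfolding r_def by (intro sum.reindex_bij_witness[of _ "\<lambda>p. Suc (n + p)" "\<lambda>m. m - Suc n"]) auto
      also have "\<dots> = dot r (G k) t" unfolding dot_def G_def t_def by (intro sum.cong) auto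
      finally show ?thesis by simp
    qed
    have "\<forall>p. t p \<noteq> 0 \<longrightarrow> Suc (n + p) \<in> R" unfolding t_def by auto
    then show ?thesis using dot R by (intro exI[of _ t]) auto
  qed
  then show ?thesis unfolding r_def by (intro exI[of _ G] allI impI) simp
qed


section \<open>Choice of the arguments and proof of the bound\<close>

theorem theorem1:
  fixes C :: "(nat \<Rightarrow> 'a::{field, finite}) set"
    and u v N n r q :: nat
  assumes "q = card (UNIV :: 'a set)"
    and "ordered_batch_code u v N n C"
    and "r = N - n"
    and "u > 0" and "v \<ge> 2" and "u * v \<le> n"
    and "q \<ge> max (4 * u * (n choose u)) 7"
  shows "((r + 2*u + 1 - v) choose (2*u))
          + (\<Sum>i = 1..u. ((r + 2*u + 1 - (v + i)) choose (2*u - i)) * ((v + i - 3) choose i))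
         \<ge> n choose u"
proof -
  \<comment> \<open>The affine span of the vectors from \<open>v - 1\<close> recovering sets has
    \<open>v - 2\<close> directions.\<close>
  define s where "s = v - 2"
  define Subs where "Subs = {I. I \<subseteq> {1..n} \<and> card I = u}"
  have card_Subs: "card Subs = n choose u" unfolding Subs_def by (simp add: n_subsets)
  have fin_Subs: "finite Subs" unfolding Subs_def by (rule finite_subset[of _ "Pow {1..n}"]) auto
  have sub: "finite I" "I \<subseteq> {1..n}" "card I = u" if "I \<in> Subs" for I
    using that finite_subset unfolding Subs_def by auto
  have "u * 1 \<le> u * v" using assms(5) by (intro mult_le_mono2) simp
  then have "u \<le> n" using assms(6) by linarith
  then have pos: "n choose u > 0" by simp

  define arcs where "arcs R I = {(j, k). j \<in> I \<and> k \<in> I \<and> k \<in> (\<Union>l\<in>{1..v}. R j l)}"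
    for R :: "nat \<Rightarrow> nat \<Rightarrow> nat set" and I
  define is_R where "is_R I R \<longleftrightarrow>
      (\<forall>j\<in>I. \<forall>l\<in>{1..v}. recovering_set C N (R j l) j) \<and>
      (\<forall>j\<in>I. \<forall>l\<in>{1..v}. \<forall>j'\<in>I. \<forall>l'\<in>{1..v}. (j, l) \<noteq> (j', l') \<longrightarrow> R j l \<inter> R j' l' = {}) \<and>
      acyclic (arcs R I)" for I R
  have "\<forall>I\<in>Subs. \<exists>R. is_R I R"
    using assms(2) unfolding ordered_batch_code_def Subs_def is_R_def arcs_def by simp
  then obtain R where R: "\<forall>I\<in>Subs. is_R I (R I)" by (rule bchoice[THEN exE])
  have rec: "recovering_set C N (R I j l) j" if "I \<in> Subs" "j \<in> I" "l \<in> {1..v}" for I j l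
    using bspec[OF R that(1)] that(2,3) unfolding is_R_def by simp
  have disj: "R I j l \<inter> R I j' l' = {}"
    if "I \<in> Subs" "j \<in> I" "l \<in> {1..v}" "j' \<in> I" "l' \<in> {1..v}" "(j, l) \<noteq> (j', l')" for I j l j' l'
    using bspec[OF R that(1)] that(2-) unfolding is_R_def by simp
  have acyc: "acyclic (arcs (R I) I)" if "I \<in> Subs" for I
    using bspec[OF R that] unfolding is_R_def by simp
  have no_loop: "j \<notin> R I j l" if "I \<in> Subs" "j \<in> I" "l \<in> {1..v}" for I j l
  proof
    assume "j \<in> R I j l"
    then have "(j, j) \<in> arcs (R I) I" using that unfolding arcs_def by auto
    then show False using acyc[OF that(1)] unfolding acyclic_def by blast
  qed

  have systematic: "systematic N n C" using assms(2) unfolding ordered_batch_code_def by blast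
  obtain G :: "nat \<Rightarrow> nat \<Rightarrow> 'a" where
    G: "\<forall>R i. recovering_set C N R i \<longrightarrow> i \<in> {1..n} - R \<longrightarrow>
      (\<exists>t. (\<forall>p. t p \<noteq> 0 \<longrightarrow> Suc (n + p) \<in> R) \<and> dot (N - n) (G i) t = 1 \<and>
        (\<forall>k\<in>{1..n} - R - {i}. dot (N - n) (G k) t = 0))"
    using systematic_recovery_vectors[OF systematic] by (rule exE)
  define is_t where "is_t I j l t \<longleftrightarrow> (\<forall>p. t p \<noteq> 0 \<longrightarrow> Suc (n + p) \<in> R I j l) \<and> dot r (G j) t = 1 \<and>
        (\<forall>k\<in>{1..n} - R I j l - {j}. dot r (G k) t = 0)" for I j l t
  define t where "t I j l = (SOME t. is_t I j l t)" for I j l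
  have "is_t I j l (t I j l)" if "I \<in> Subs" "j \<in> I" "l \<in> {1..v}" for I j l
  proof -
    have "\<exists>t. is_t I j l t"
      unfolding is_t_def assms(3) using that sub[OF that(1)]
      by (intro G[rule_format] rec DiffI no_loop) auto
    then show ?thesis unfolding t_def by (rule someI_ex)
  qed
  then have t_supp: "t I j l p \<noteq> 0 \<Longrightarrow> Suc (n + p) \<in> R I j l" and t_one: "dot r (G j) (t I j l) = 1"
    and t_zero: "k \<in> {1..n} \<Longrightarrow> k \<noteq> j \<Longrightarrow> k \<notin> R I j l \<Longrightarrow> dot r (G k) (t I j l) = 0"
    if "I \<in> Subs" "j \<in> I" "l \<in> {1..v}" for I j l k p
    using that unfolding is_t_def by blast+

  define X where "X = (SIGMA I:Subs. I)"
  have X: "finite X" "card X < card (UNIV :: 'a set)"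
  proof -
    show "finite X" unfolding X_def using fin_Subs sub by (intro finite_SigmaI) auto
    have "card X = (\<Sum>I\<in>Subs. card I)" unfolding X_def using fin_Subs sub by (intro card_SigmaI) auto
    also have "\<dots> = u * (n choose u)" using sub card_Subs by simp
    also have "\<dots> < 4 * u * (n choose u)" using assms(4) pos by simp
    finally show "card X < card (UNIV :: 'a set)" using assms(1,7) by simp
  qed
  \<comment> \<open>Recovering set \<open>1\<close> is reserved for \<open>y_j\<close>. Sets
    \<open>2\<close> to \<open>v\<close> span the affine space: base point from set
    \<open>2\<close>, directions towards sets \<open>3\<close> to \<open>v\<close>, whence the shift
    \<open>i + 3\<close>.\<close>
  define w where "w x = t (fst x) (snd x) 2" for x
  define d where "d x i = (\<lambda>p. t (fst x) (snd x) (i + 3) p - t (fst x) (snd x) 2 p)" for x i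
  have d_indep: "\<forall>x\<in>X. \<forall>a. (\<forall>p<r. (\<Sum>i<s. a i * d x i p) = 0) \<longrightarrow> (\<forall>i<s. a i = 0)"
  proof (intro ballI allI impI)
    fix x a i assume x: "x \<in> X" and zero: "\<forall>p<r. (\<Sum>i<s. a i * d x i p) = 0" and i: "i < s"
    obtain I j where Ij: "x = (I, j)" "I \<in> Subs" "j \<in> I" using x unfolding X_def by auto
    \<comment> \<open>The value \<open>1\<close> forces a nonzero entry at some
      \<open>p < r\<close>. The recovering sets of \<open>j\<close> are disjoint, so all other
      vectors of \<open>j\<close> vanish at \<open>p\<close>, and this coordinate isolates
      \<open>a i\<close>.\<close>
    have "dot r (G j) (t I j (i + 3)) = 1" using Ij i by (intro t_one) (auto simp: s_def)
    then obtain p where p: "p < r" "t I j (i + 3) p \<noteq> 0"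
      unfolding dot_def by (metis (no_types, lifting) lessThan_iff mult_zero_right sum.neutral zero_neq_one)
    have inR: "Suc (n + p) \<in> R I j (i + 3)" using Ij i p by (intro t_supp) (auto simp: s_def)
    have other: "t I j l p = 0" if l: "l \<in> {1..v}" "l \<noteq> i + 3" for l
    proof (rule ccontr)
      assume "t I j l p \<noteq> 0"
      then have "Suc (n + p) \<in> R I j l" using Ij l by (intro t_supp) auto
      moreover have "R I j l \<inter> R I j (i + 3) = {}"
        using Ij l i by (intro disj) (auto simp: s_def)
      ultimately show False using inR by blast
    qed
    have "(\<Sum>k<s. a k * d x k p) = (\<Sum>k<s. if k = i then a i * t I j (i + 3) p else 0)"
      using assms(5) i unfolding d_def by (intro sum.cong) (auto simp: Ij other s_def)
    also have "\<dots> = a i * t I j (i + 3) p" using i by simp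
    finally show "a i = 0" using zero p by simp
  qed
  obtain \<phi> where \<phi>_supp: "\<forall>m<s. \<forall>p\<ge>r. \<phi> m p = 0"
    and \<phi>_sol: "\<forall>x\<in>X. \<exists>a. \<forall>m<s. dot r (\<phi> m) (\<lambda>p. w x p + (\<Sum>i<s. a i * d x i p)) = 0"
    and \<phi>_nondeg: "\<forall>x\<in>X. \<forall>c. (\<forall>i<s. (\<Sum>m<s. c m * dot r (\<phi> m) (d x i)) = 0) \<longrightarrow> (\<forall>m<s. c m = 0)"
    using exists_transversal_functionals[OF X d_indep, where w = w] by blast
  obtain a where a: "\<And>x m. x \<in> X \<Longrightarrow> m < s \<Longrightarrow> dot r (\<phi> m) (\<lambda>p. w x p + (\<Sum>i<s. a x i * d x i p)) = 0"
    using bchoice[OF \<phi>_sol] by blast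
  define g where "g x = (\<lambda>p. w x p + (\<Sum>i<s. a x i * d x i p))" for x
  have dot_g: "dot r f (g (I, j)) =
      dot r f (t I j 2) + (\<Sum>i<s. a (I, j) i * (dot r f (t I j (i + 3)) - dot r f (t I j 2)))" for f I j
    unfolding g_def w_def d_def by (simp add: dot_linear)
  \<comment> \<open>\<open>G j\<close> takes the value \<open>1\<close> at every vector of
    \<open>j\<close>, so it vanishes on the directions; affine combinations therefore keep the value
    \<open>1\<close>.\<close>
  have g_one: "dot r (G j) (g (I, j)) = 1" if "I \<in> Subs" "j \<in> I" for I j
    using that assms(5) by (auto simp: dot_g t_one s_def intro!: sum.neutral)
  have g_zero: "dot r (G k) (g (I, j)) = 0"
    if "I \<in> Subs" "j \<in> I" "k \<in> {1..n}" "k \<noteq> j" "k \<notin> (\<Union>l\<in>{2..v}. R I j l)" for I j k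
    using that assms(5) by (auto simp: dot_g t_zero s_def intro!: sum.neutral)

  obtain B where B: "finite B" "\<phi> ` {..<s} \<subseteq> B" "card B \<le> r" "card (\<phi> ` {..<s}) = s"
    and B_span: "\<And>f. \<exists>\<beta>. \<forall>t. dot r f t = (\<Sum>g\<in>B. \<beta> g * dot r g t)"
  proof (rule extend_functionals_to_basis[OF \<phi>_supp])
    fix c assume c: "\<forall>p. (\<Sum>m<s. c m * \<phi> m p) = 0"
    \<comment> \<open>Nonsingularity at a single pair \<open>(I, j)\<close> suffices for
      independence, and a pair exists because \<open>0 < u \<le> n\<close>.\<close>
    obtain I where "I \<in> Subs" using pos card_Subs by fastforce
    then obtain j where "(I, j) \<in> X" using sub[of I] assms(4) unfolding X_def by fastforce
    moreover have "(\<Sum>m<s. c m * dot r (\<phi> m) f) = 0" for f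
    proof -
      have "(\<Sum>m<s. c m * dot r (\<phi> m) f) = dot r f (\<lambda>p. \<Sum>m<s. c m * \<phi> m p)"
        by (simp add: dot_linear dot_commute[of r f])
      then show ?thesis using c by (simp add: dot_def)
    qed
    ultimately show "\<forall>m<s. c m = 0" using \<phi>_nondeg by blast
  qed blast
  define S where "S = \<phi> ` {..<s}"
  have "\<forall>k. \<exists>\<beta>. \<forall>t. dot r (G k) t = (\<Sum>g\<in>B. \<beta> g * dot r g t)" using B_span by blast
  from choice[OF this] obtain \<beta> where \<beta>: "\<And>k t. dot r (G k) t = (\<Sum>g\<in>B. \<beta> k g * dot r g t)"
    by blast

  have "\<forall>I\<in>Subs. \<exists>e. bij_betw e {..<u} I"
    using ex_bij_betw_nat_finite sub(1,3) by (metis atLeast0LessThan)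
  from bchoice[OF this] obtain e where e: "\<And>I. I \<in> Subs \<Longrightarrow> bij_betw (e I) {..<u} I" by blast
  have eI: "e I m \<in> I" if "I \<in> Subs" "m < u" for I m
    using e[OF that(1)] that(2) unfolding bij_betw_def by auto
  define z where "z I a = (if snd a then t I (e I (fst a)) 1 else g (I, e I (fst a)))" for I and a :: "nat \<times> bool"
  \<comment> \<open>Numbers of the recovering sets whose union controls the support of the vector in
    a slot. They are disjoint for the two slots of one index.\<close>
  define L where "L b = (if b then {1} else {2..v})" for b
  have Lv: "L b \<subseteq> {1..v}" for b using assms(5) unfolding L_def by auto
  have z_one: "dot r (G (e I (fst a))) (z I a) = 1" if "I \<in> Subs" "a \<in> {..<u} \<times> UNIV" for I a
    using that assms(5) eI unfolding z_def by (auto intro!: t_one g_one)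
  have z_supp: "k \<in> (\<Union>l\<in>L (snd a). R I (e I (fst a)) l)"
    if "I \<in> Subs" "a \<in> {..<u} \<times> UNIV" "k \<in> {1..n}" "k \<noteq> e I (fst a)" "dot r (G k) (z I a) \<noteq> 0" for I a k
  proof -
    have j: "e I (fst a) \<in> I" using that(2) by (intro eI[OF that(1)]) auto
    show ?thesis
    proof (cases "snd a")
      case True
      have "1 \<in> {1..v}" using assms(5) by simp
      then show ?thesis
        using True t_zero[OF that(1) j _ that(3,4)] that(5) unfolding z_def L_def by auto
    next
      case False
      then show ?thesis
        using g_zero[OF that(1) j that(3,4)] that(5) unfolding z_def L_def by auto
    qed
  qed
  let ?A = "{..<u} \<times> (UNIV :: bool set)"
  let ?D = "\<lambda>a :: nat \<times> bool. if snd a then B else B - S"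
  have "pair_form ?A K (\<lambda>a k. dot r (G k) (z I a)) = of_bool (I = K)"
    if I: "I \<in> Subs" and K: "K \<in> Subs" for I K
  proof (rule pair_form_eq_of_bool[where arcs = "arcs (R I) I", OF e[OF I] sub(1,3)[OF K]])
    show "arcs (R I) I \<subseteq> I \<times> I" unfolding arcs_def by auto
    show "acyclic (arcs (R I) I)" by (rule acyc[OF I])
    show "dot r (G (e I (fst a))) (z I a) = 1" if "a \<in> ?A" for a using z_one I that .
    show "(e I (fst a), k) \<in> arcs (R I) I"
      if ak: "a \<in> ?A" "k \<in> I" "k \<noteq> e I (fst a)" "dot r (G k) (z I a) \<noteq> 0" for a k
    proof -
      have "k \<in> {1..n}" using ak(2) sub(2)[OF I] by blast
      then obtain l where "l \<in> L (snd a)" "k \<in> R I (e I (fst a)) l"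
        using z_supp[OF I ak(1) _ ak(3,4)] by blast
      moreover have "e I (fst a) \<in> I" using ak(1) by (intro eI[OF I]) auto
      ultimately show ?thesis using ak(2) Lv unfolding arcs_def by blast
    qed
    show "dot r (G k) (z I a) = 0 \<or> dot r (G k) (z I a') = 0"
      if aa: "a \<in> ?A" "a' \<in> ?A" "a \<noteq> a'" and k: "k \<in> K - I" for a a' k
    proof (rule ccontr)
      assume "\<not> ?thesis"
      moreover have "k \<in> {1..n}" "k \<noteq> e I (fst a)" "k \<noteq> e I (fst a')"
        using k aa eI[OF I] sub(2)[OF K] by auto
      ultimately obtain l l' where l: "l \<in> L (snd a)" "k \<in> R I (e I (fst a)) l"
        and l': "l' \<in> L (snd a')" "k \<in> R I (e I (fst a')) l'"
        using z_supp[OF I, of _ k] aa by blast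
      \<comment> \<open>Distinct slots either belong to distinct indices or draw on disjoint ranges
        \<open>L\<close>, so \<open>k\<close> would lie in two disjoint recovering sets.\<close>
      have "(e I (fst a), l) \<noteq> (e I (fst a'), l')"
      proof
        assume eq: "(e I (fst a), l) = (e I (fst a'), l')"
        then have "fst a = fst a'"
          using e[OF I] aa unfolding bij_betw_def inj_on_def by auto
        moreover have "snd a = snd a'" using eq l(1) l'(1) unfolding L_def by (auto split: if_splits)
        ultimately show False using aa(3) by (simp add: prod_eq_iff)
      qed
      then have "R I (e I (fst a)) l \<inter> R I (e I (fst a')) l' = {}"
        using aa l(1) l'(1) by (intro disj[OF I] eI[OF I] subsetD[OF Lv]) auto
      then show False using l l' by blast
    qed
  qed
  moreover have "dot r (G k) (z I a) = (\<Sum>p\<in>?D a. dot r p (z I a) * \<beta> k p)"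
    if "I \<in> Subs" "a \<in> ?A" for I a k
  proof -
    \<comment> \<open>The \<open>False\<close> slots hold vectors \<open>g\<close>, chosen in the
      common kernel of \<open>S\<close>; their expansion over \<open>B\<close> thus reduces to
      \<open>B - S\<close>.\<close>
    have "dot r p (z I a) = 0" if p: "p \<in> S" and "\<not> snd a" for p
    proof -
      have "(I, e I (fst a)) \<in> X" using eI \<open>I \<in> Subs\<close> \<open>a \<in> ?A\<close> unfolding X_def by auto
      then show ?thesis using a p \<open>\<not> snd a\<close> unfolding z_def g_def S_def by auto
    qed
    then show ?thesis
      unfolding \<beta> using B(1) by (intro sum.mono_neutral_cong_right) (auto simp: mult.commute split: if_splits)
  qed
  ultimately have "card Subs \<le> card ((\<lambda>\<sigma>. image_mset \<sigma> (mset_set ?A)) ` PiE ?A ?D)"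
    using B(1) fin_Subs
    by (intro card_le_card_multisets[where val = "\<lambda>I a k. dot r (G k) (z I a)"
          and z = "\<lambda>I a p. dot r p (z I a)" and b = \<beta>]) auto
  also have "\<dots> \<le> (\<Sum>i\<le>u. ((card S + i - 1) choose i) * ((card (B - S) + (2*u - i) - 1) choose (2*u - i)))"
    using B(1,2) unfolding S_def by (rule card_image_multisets_le)
  also have "\<dots> \<le> (\<Sum>i\<le>u. ((r + 2*u + 1 - (v + i)) choose (2*u - i)) * ((v + i - 3) choose i))"
  proof (rule sum_mono)
    fix i assume i: "i \<in> {..u}"
    have "card (B - S) = card B - s" "s \<le> card B"
      using B unfolding S_def by (auto simp: card_Diff_subset dest: card_mono)
    \<comment> \<open>At most \<open>r - (v - 2)\<close> basis elements lie outside
      \<open>S\<close>; the truncated subtractions are exact because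
      \<open>s \<le> card B \<le> r\<close> and \<open>2*u - i \<ge> 1\<close>.\<close>
    then have "card (B - S) + (2*u - i) - 1 \<le> r + 2*u + 1 - (v + i)"
      using B(3) i assms(4,5) unfolding s_def by auto
    moreover have "((card S + i - 1) choose i) = ((v + i - 3) choose i)"
      using B(4) assms(5) unfolding S_def s_def by (cases "i = 0") (auto simp: numeral_eq_Suc)
    ultimately show "((card S + i - 1) choose i) * ((card (B - S) + (2*u - i) - 1) choose (2*u - i))
        \<le> ((r + 2*u + 1 - (v + i)) choose (2*u - i)) * ((v + i - 3) choose i)"
      by (simp add: mult.commute binomial_right_mono)
  qed
  \<comment> \<open>The term \<open>i = 0\<close> is split off; its second factor is a binomial
    coefficient over \<open>0\<close>, hence \<open>1\<close> even when \<open>v - 3\<close>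
    truncates.\<close>
  also have "\<dots> = ((r + 2*u + 1 - v) choose (2*u))
      + (\<Sum>i = 1..u. ((r + 2*u + 1 - (v + i)) choose (2*u - i)) * ((v + i - 3) choose i))"
    by (simp add: atMost_atLeast0 sum.atLeast_Suc_atMost)
  finally show ?thesis using card_Subs by simp
qed

end
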